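(* Consider a controlled Markov chain $\{\theta_i,X_i\}$ with $(\theta_0,X_0)=(\theta,x)\in\Theta\times\mathsf{X}$, and suppose that the assumption (A1), with parameter $s\in\{0,1\}$, described in the context holds, with associated $V,w,\Delta_V,\Delta_w,\mathcal{C},\{\gamma_i\},i_0,\delta,\upsilon_v,\upsilon_w$. For $i\ge 1$ and $(\theta,x)\in\Theta\times\mathsf{X}$ define $$W_i(\theta,x):=V^{\upsilon_v}(x)+w^{\upsilon_w}(\theta)/\gamma_i,\qquad U_i(\theta,x):=\gamma_iW_i(\theta,x).$$ Then: (1) If $s=1$ and $\bar\ell:=\limsup_{i\to\infty}(\gamma_{i+1}^{-1}-\gamma_i^{-1})<\delta$, then for any $\delta_W\in(0,\delta-\bar\ell)$ there exists $i_W\ge i_0\vee 1$ such that for any $i\ge i_W$, whenever $(\theta_i,X_i)\notin\mathcal{C}$, $\mathbb{P}_{\theta,x}$-a.s. $$\mathbb{E}_{\theta,x}[W_{i+1}(\theta_{i+1},X_{i+1})\mid\mathcal{F}_i]\le W_i(\theta_i,X_i)-\delta_W,$$ and $\mathbb{E}_{\theta,x}[W_i(\theta_i,X_i)]<\infty$; moreover $\sum_{i=1}^\infty\mathbb{I}\{(\theta_i,X_i)\in\mathcal{C}\}=\infty$, $\mathbb{P}_{\theta,x}$-almost surely. (2) If $s=0$ and $\{\gamma_i\}$ is nonincreasing, then for any $i\ge i_0\vee 1$, whenever $(\theta_i,X_i)\notin\mathcal{C}$, $\mathbb{P}_{\theta,x}$-a.s. $$\mathbb{E}_{\theta,x}[U_{i+1}(\theta_{i+1},X_{i+1})\mid\mathcal{F}_i]\le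 U_i(\theta_i,X_i)-\delta\gamma_{i+1},$$ and moreover $\mathbb{E}_{\theta,x}[U_i(\theta_i,X_i)]<\infty$. If in addition $\sum_{i=1}^\infty\gamma_i=\infty$, then $\sum_{i=1}^\infty\mathbb{I}\{(\theta_i,X_i)\in\mathcal{C}\}=\infty$, $\mathbb{P}_{\theta,x}$-almost surely.
   Context: Controlled Markov chain: $\mathsf{X}\subset\mathbb{R}^{n_x}$, $\Theta\subset\mathbb{R}^{n_\theta}$, and $\{P_\theta,\theta\in\Theta\}$ is a family of Markov transition probabilities on $(\mathsf{X},\mathcal{B}(\mathsf{X}))$. Given mappings $\phi_i:\Theta\times\mathsf{X}^{i+1}\to\Theta$ ($i\ge1$), the process starts from $(\theta_0,X_0)=(\theta,x)$ and, for $i\ge0$, $X_{i+1}\mid(\theta_0,X_0,\ldots,X_i)\sim P_{\theta_i}(X_i,\cdot)$ and $\theta_{i+1}:=\phi_{i+1}(\theta_0,X_0,X_1,\ldots,X_{i+1})$. Its law and expectation are denoted $\mathbb{P}_{\theta,x}$ and $\mathbb{E}_{\theta,x}$; $\mathcal{F}_i:=\sigma(\theta_0,X_0,X_1,\ldots,X_i)$; $a\vee b:=\max\{a,b\}$. Assumption (A1) with $s\in\{0,1\}$: $V:\mathsf{X}\to[1,\infty)$ and $w:\Theta\to[1,\infty)$ are functions for which there exist functions $\Delta_w,\Delta_V:\Theta\times\mathsf{X}\to\mathbb{R}$, a set $\mathcal{C}\subset\Theta\times\mathsf{X}$ and a sequence of strictly positive real numbers $\{\gamma_i,i\ge1\}$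 such that: (i) $\{\gamma_i\}$ is bounded; (ii) for some integer $i_0\ge0$, $\mathbb{P}_{\theta,x}$-a.s. for all $i\ge i_0$, $$\mathbb{E}_{\theta,x}[w(\theta_{i+1})\mid\mathcal{F}_i]\le w(\theta_i)-\gamma_{i+1}\Delta_w(\theta_i,X_i),\qquad \mathbb{E}_{\theta,x}[V(X_{i+1})\mid\mathcal{F}_i]\le V(X_i)-\Delta_V(\theta_i,X_i),$$ and $\mathbb{E}_{\theta,x}[w(\theta_i)]<\infty$, $\mathbb{E}_{\theta,x}[V(X_i)]<\infty$; (iii) there exist constants $\delta\in(0,\infty)$ and $\upsilon_v,\upsilon_w\in(0,1]$ such that $$\upsilon_w\frac{\Delta_w(\theta,x)}{w^{1-\upsilon_w}(\theta)}+\upsilon_v\frac{\Delta_V(\theta,x)}{V^{1-\upsilon_v}(x)}\ge\delta\, w^{s\times\upsilon_w}(\theta)\quad\text{for }(\theta,x)\notin\mathcal{C},$$ and $\sup_{(\theta,x)\in\mathcal{C}}|\Delta_w(\theta,x)|\vee|\Delta_V(\theta,x)|<\infty$. *)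

theory Defs
  imports "HOL-Probability.Probability"
begin

text \<open>The sigma-algebra generated by \<open>\<theta>\<^sub>0, X\<^sub>0, \<dots>, X\<^sub>i\<close>.\<close>

definition history_algebra ::
  "'w measure \<Rightarrow> (real ^ 'nx) set \<Rightarrow> (real ^ 'nt) set \<Rightarrow> (nat \<Rightarrow> 'w \<Rightarrow> real ^ 'nt)
    \<Rightarrow> (nat \<Rightarrow> 'w \<Rightarrow> real ^ 'nx) \<Rightarrow> nat \<Rightarrow> 'w measure"
  where "history_algebra M \<X> \<Theta> \<theta> X i =
    vimage_algebra (space M) (\<lambda>\<omega>. (\<theta> 0 \<omega>, \<lambda>j\<in>{..i}. X j \<omega>))
      (restrict_space borel \<Theta> \<Otimes>\<^sub>M (\<Pi>\<^sub>M j\<in>{..i}. restrict_space borel \<X>))"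

text \<open>
  A controlled Markov chain on an arbitrary probability space \<open>M\<close>. The sets \<open>\<X>\<close> and \<open>\<Theta>\<close> are
  arbitrary subsets of Euclidean spaces and carry the trace of the Borel sigma-algebra. The history
  \<open>(x\<^sub>0, \<dots>, x\<^sub>i)\<close> passed to \<open>\<phi> i\<close> is a function on the index set \<open>{..i}\<close>.
\<close>

locale controlled_markov_chain = prob_space M
  for M :: "'w measure" +
  fixes \<X> :: "(real ^ 'nx) set"
    and \<Theta> :: "(real ^ 'nt) set"
    and P :: "real ^ 'nt \<Rightarrow> real ^ 'nx \<Rightarrow> (real ^ 'nx) measure"
    and \<phi> :: "nat \<Rightarrow> real ^ 'nt \<Rightarrow> (nat \<Rightarrow> real ^ 'nx) \<Rightarrow> real ^ 'nt"
    and \<theta>\<^sub>0 :: "real ^ 'nt"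
    and x\<^sub>0 :: "real ^ 'nx"
    and \<theta> :: "nat \<Rightarrow> 'w \<Rightarrow> real ^ 'nt"
    and X :: "nat \<Rightarrow> 'w \<Rightarrow> real ^ 'nx"
  assumes kernel: "th \<in> \<Theta> \<Longrightarrow> P th \<in> restrict_space borel \<X> \<rightarrow>\<^sub>M prob_algebra (restrict_space borel \<X>)"
    and measurable_\<phi>: "i \<ge> 1 \<Longrightarrow> (\<lambda>(th, xs). \<phi> i th xs) \<in>
        restrict_space borel \<Theta> \<Otimes>\<^sub>M (\<Pi>\<^sub>M j\<in>{..i}. restrict_space borel \<X>) \<rightarrow>\<^sub>M restrict_space borel \<Theta>"
    and measurable_\<theta>\<^sub>0: "\<theta> 0 \<in> M \<rightarrow>\<^sub>M restrict_space borel \<Theta>"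
    and measurable_X: "X i \<in> M \<rightarrow>\<^sub>M restrict_space borel \<X>"
    and init_in: "\<theta>\<^sub>0 \<in> \<Theta>" "x\<^sub>0 \<in> \<X>"
    and init: "AE \<omega> in M. \<theta> 0 \<omega> = \<theta>\<^sub>0 \<and> X 0 \<omega> = x\<^sub>0"
    and transition: "A \<in> sets (restrict_space borel \<X>) \<Longrightarrow>
        AE \<omega> in M.
          real_cond_exp M (history_algebra M \<X> \<Theta> \<theta> X i)
            (\<lambda>\<omega>. indicator A (X (Suc i) \<omega>)) \<omega>
          = measure (P (\<theta> i \<omega>) (X i \<omega>)) A"
    and parameter: "\<omega> \<in> space M \<Longrightarrow> \<theta> (Suc i) \<omega> = \<phi> (Suc i) (\<theta> 0 \<omega>) (\<lambda>j\<in>{..Suc i}. X j \<omega>)"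

lemma (in controlled_markov_chain) subalgebra_history:
  "subalgebra M (history_algebra M \<X> \<Theta> \<theta> X i)"
proof -
  note [measurable] = measurable_\<theta>\<^sub>0 measurable_X
  let ?N = "restrict_space borel \<Theta> \<Otimes>\<^sub>M (\<Pi>\<^sub>M j\<in>{..i}. restrict_space borel \<X>)"
  have *: "(\<lambda>\<omega>. (\<theta> 0 \<omega>, \<lambda>j\<in>{..i}. X j \<omega>)) \<in> M \<rightarrow>\<^sub>M ?N"
    by measurable
  then have "(\<lambda>\<omega>. (\<theta> 0 \<omega>, \<lambda>j\<in>{..i}. X j \<omega>)) \<in> space M \<rightarrow> space ?N"
    by (rule measurable_space[THEN funcsetI])
  from sets_vimage_algebra2[OF this] show ?thesis
    unfolding subalgebra_def history_algebra_def
    using measurable_sets[OF *] by auto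
qed

text \<open>
  The drift assumption. The bounds are required along the given chain, which starts from the fixed
  point \<open>(\<theta>\<^sub>0, x\<^sub>0)\<close>. Measurability of \<open>V\<close> and \<open>w\<close> is what makes \<open>V (X i)\<close> and \<open>w (\<theta> i)\<close> random
  variables; no measurability is asked of \<open>\<Delta>\<^sub>w\<close>, \<open>\<Delta>\<^sub>V\<close> and \<open>\<C>\<close>. The value \<open>\<gamma> 0\<close> is irrelevant.
\<close>

locale drift_assumption = controlled_markov_chain M \<X> \<Theta> P \<phi> \<theta>\<^sub>0 x\<^sub>0 \<theta> X
  for M :: "'w measure"
    and \<X> :: "(real ^ 'nx) set"
    and \<Theta> :: "(real ^ 'nt) set"
    and P \<phi> \<theta>\<^sub>0 x\<^sub>0 \<theta> X +
  fixes s :: nat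
    and V :: "real ^ 'nx \<Rightarrow> real"
    and w :: "real ^ 'nt \<Rightarrow> real"
    and \<Delta>\<^sub>V \<Delta>\<^sub>w :: "real ^ 'nt \<Rightarrow> real ^ 'nx \<Rightarrow> real"
    and \<C> :: "((real ^ 'nt) \<times> (real ^ 'nx)) set"
    and \<gamma> :: "nat \<Rightarrow> real"
    and i\<^sub>0 :: nat
    and \<delta> \<upsilon>\<^sub>v \<upsilon>\<^sub>w :: real
  assumes s_cases: "s \<in> {0, 1}"
    and V_measurable: "V \<in> borel_measurable (restrict_space borel \<X>)"
    and w_measurable: "w \<in> borel_measurable (restrict_space borel \<Theta>)"
    and V_ge_1: "x \<in> \<X> \<Longrightarrow> V x \<ge> 1"
    and w_ge_1: "th \<in> \<Theta> \<Longrightarrow> w th \<ge> 1"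
    and C_subset: "\<C> \<subseteq> \<Theta> \<times> \<X>"
    and \<gamma>_pos: "i \<ge> 1 \<Longrightarrow> \<gamma> i > 0"
    and \<gamma>_bounded: "bounded (\<gamma> ` {1..})"
    and w_drift: "AE \<omega> in M. \<forall>i\<ge>i\<^sub>0.
        real_cond_exp M (history_algebra M \<X> \<Theta> \<theta> X i) (\<lambda>\<omega>. w (\<theta> (i + 1) \<omega>)) \<omega>
          \<le> w (\<theta> i \<omega>) - \<gamma> (i + 1) * \<Delta>\<^sub>w (\<theta> i \<omega>) (X i \<omega>)"
    and V_drift: "AE \<omega> in M. \<forall>i\<ge>i\<^sub>0.
        real_cond_exp M (history_algebra M \<X> \<Theta> \<theta> X i) (\<lambda>\<omega>. V (X (i + 1) \<omega>)) \<omega>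
          \<le> V (X i \<omega>) - \<Delta>\<^sub>V (\<theta> i \<omega>) (X i \<omega>)"
    and w_integrable: "i \<ge> i\<^sub>0 \<Longrightarrow> integrable M (\<lambda>\<omega>. w (\<theta> i \<omega>))"
    and V_integrable: "i \<ge> i\<^sub>0 \<Longrightarrow> integrable M (\<lambda>\<omega>. V (X i \<omega>))"
    and \<delta>_pos: "\<delta> > 0"
    and \<upsilon>\<^sub>v_range: "\<upsilon>\<^sub>v \<in> {0<..1}"
    and \<upsilon>\<^sub>w_range: "\<upsilon>\<^sub>w \<in> {0<..1}"
    and drift_outside: "th \<in> \<Theta> \<Longrightarrow> x \<in> \<X> \<Longrightarrow> (th, x) \<notin> \<C> \<Longrightarrow>
        \<upsilon>\<^sub>w * (\<Delta>\<^sub>w th x / w th powr (1 - \<upsilon>\<^sub>w)) + \<upsilon>\<^sub>v * (\<Delta>\<^sub>V th x / V x powr (1 - \<upsilon>\<^sub>v))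
          \<ge> \<delta> * w th powr (real s * \<upsilon>\<^sub>w)"
    and drift_bounded: "bdd_above ((\<lambda>(th, x). max \<bar>\<Delta>\<^sub>w th x\<bar> \<bar>\<Delta>\<^sub>V th x\<bar>) ` \<C>)"

definition W_fun ::
  "('x \<Rightarrow> real) \<Rightarrow> ('t \<Rightarrow> real) \<Rightarrow> (nat \<Rightarrow> real) \<Rightarrow> real \<Rightarrow> real \<Rightarrow> nat \<Rightarrow> 't \<Rightarrow> 'x \<Rightarrow> real"
  where "W_fun V w \<gamma> \<upsilon>\<^sub>v \<upsilon>\<^sub>w i th x = V x powr \<upsilon>\<^sub>v + w th powr \<upsilon>\<^sub>w / \<gamma> i"

definition U_fun ::
  "('x \<Rightarrow> real) \<Rightarrow> ('t \<Rightarrow> real) \<Rightarrow> (nat \<Rightarrow> real) \<Rightarrow> real \<Rightarrow> real \<Rightarrow> nat \<Rightarrow> 't \<Rightarrow> 'x \<Rightarrow> real"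
  where "U_fun V w \<gamma> \<upsilon>\<^sub>v \<upsilon>\<^sub>w i th x = \<gamma> i * W_fun V w \<gamma> \<upsilon>\<^sub>v \<upsilon>\<^sub>w i th x"

end

theory Submission
  imports Defs
begin

text \<open>Concavity of \<open>t \<mapsto> t powr p\<close> transfers the drifts of \<open>V\<close> and \<open>w\<close> to \<open>V powr \<upsilon>\<^sub>v\<close> and \<open>w powr \<upsilon>\<^sub>w\<close>,
  and adding them with weights \<open>1\<close> and \<open>1 / \<gamma> (i + 1)\<close> produces exactly the combination of
  \<open>\<Delta>\<^sub>V\<close> and \<open>\<Delta>\<^sub>w\<close> that is bounded below outside \<open>\<C>\<close>. Recurrence follows since a nonnegative
  integrable process cannot lose amounts \<open>c n\<close> of infinite total sum on average: if the drift
  inequality held from time \<open>m\<close> on with probability \<open>q > 0\<close>, then telescoping up to its first failure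
  would give \<open>q * (\<Sum>n\<ge>m. c n) \<le> expectation (Y m)\<close>.\<close>

section \<open>Concavity of powers and conditional Jensen\<close>

text \<open>Young's inequality for \<open>y\<close> and \<open>a\<close> with weights
  \<open>p\<close> and \<open>1 - p\<close>, multiplied by \<open>a powr (p - 1)\<close>. The
  right-hand side is the tangent at \<open>a\<close>, written so that its dependence on
  \<open>y\<close> is a single product.\<close>

lemma powr_le_tangent:
  fixes a y p :: real
  assumes "0 < a" "0 < y" "0 \<le> p" "p \<le> 1"
  shows "y powr p \<le> (1 - p) * a powr p + p * a powr (p - 1) * y"
proof -
  have "y powr p * a powr (1 - p) \<le> p * y + (1 - p) * a"
    using assms by (intro Youngs_inequality_0) auto
  then have "(y powr p * a powr (1 - p)) * a powr (p - 1) \<le> (p * y + (1 - p) * a) * a powr (p - 1)"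
    by (rule mult_right_mono) simp
  moreover have "a powr (1 - p) * a powr (p - 1) = 1"
    using assms by (simp add: powr_add[symmetric])
  moreover have "a * a powr (p - 1) = a powr p"
    using assms powr_add[of a 1 "p - 1"] by simp
  ultimately show ?thesis
    by (simp add: distrib_right mult.assoc) (simp add: mult_ac)
qed

lemma integrable_powr:
  fixes f :: "'a \<Rightarrow> real"
  assumes "integrable M f" "\<And>x. x \<in> space M \<Longrightarrow> 1 \<le> f x" "p \<le> 1"
  shows "integrable M (\<lambda>x. f x powr p)"
proof (rule Bochner_Integration.integrable_bound[OF assms(1)])
  show "(\<lambda>x. f x powr p) \<in> borel_measurable M"
    using assms(1) by measurable
  have "norm (f x powr p) \<le> norm (f x)" if "x \<in> space M" for x
    using powr_mono[OF assms(3), of "f x"] assms(2)[OF that] by simp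
  then show "AE x in M. norm (f x powr p) \<le> norm (f x)"
    by (rule AE_I2)
qed

text \<open>Conditional Jensen for \<open>t \<mapsto> t powr p\<close> combined with its tangent bound. Taking the tangent at
  the \<open>F\<close>-measurable point \<open>f\<close> makes the bound affine in \<open>g\<close>, so linearity of conditional expectation
  suffices.\<close>

lemma (in sigma_finite_subalgebra) real_cond_exp_powr_le:
  fixes f g :: "'a \<Rightarrow> real"
  assumes f_F [measurable]: "f \<in> borel_measurable F"
    and f: "integrable M f" and g: "integrable M g"
    and f_ge: "\<And>x. x \<in> space M \<Longrightarrow> 1 \<le> f x" and g_ge: "\<And>x. x \<in> space M \<Longrightarrow> 1 \<le> g x"
    and p: "0 \<le> p" "p \<le> 1"
  shows "AE x in M. real_cond_exp M F (\<lambda>x. g x powr p) x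
    \<le> f x powr p + p * ((real_cond_exp M F g x - f x) / f x powr (1 - p))"
proof -
  let ?a = "\<lambda>x. (1 - p) * f x powr p" and ?b = "\<lambda>x. p * f x powr (p - 1)"
  have [measurable]: "f \<in> borel_measurable M" "g \<in> borel_measurable M"
    using f g by auto
  have int_a: "integrable M ?a"
    using integrable_powr[OF f f_ge p(2)] by simp
  \<comment> \<open>The slope \<open>?b\<close> lies between 0 and 1 because \<open>f\<close> is at
    least 1 and \<open>p - 1 \<le> 0\<close>, so the product is dominated by
    \<open>g\<close>.\<close>
  have int_bg: "integrable M (\<lambda>x. ?b x * g x)"
  proof (rule Bochner_Integration.integrable_bound[OF g])
    have "norm (?b x * g x) \<le> norm (g x)" if "x \<in> space M" for x
    proof -
      have "f x powr (p - 1) \<le> 1"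
        using f_ge[OF that] p powr_mono[of "p - 1" 0 "f x"] by simp
      then have "p * f x powr (p - 1) \<le> 1"
        using p by (intro mult_le_one) auto
      then show ?thesis
        using p by (auto simp: abs_mult intro!: mult_left_le_one_le)
    qed
    then show "AE x in M. norm (?b x * g x) \<le> norm (g x)"
      by (rule AE_I2)
  qed measurable
  have "AE x in M. real_cond_exp M F (\<lambda>x. g x powr p) x \<le> real_cond_exp M F (\<lambda>x. ?a x + ?b x * g x) x"
  proof (rule real_cond_exp_mono)
    show "AE x in M. g x powr p \<le> ?a x + ?b x * g x"
      using f_ge g_ge p by (intro AE_I2 powr_le_tangent) force+
  qed (use int_a int_bg integrable_powr[OF g g_ge p(2)] in auto)
  moreover have "AE x in M. real_cond_exp M F (\<lambda>x. ?a x + ?b x * g x) x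
      = real_cond_exp M F ?a x + real_cond_exp M F (\<lambda>x. ?b x * g x) x"
    by (rule real_cond_exp_add[OF int_a int_bg])
  moreover have "AE x in M. real_cond_exp M F ?a x = ?a x"
    by (rule real_cond_exp_F_meas[OF int_a]) measurable
  moreover have "AE x in M. real_cond_exp M F (\<lambda>x. ?b x * g x) x = ?b x * real_cond_exp M F g x"
    by (rule real_cond_exp_mult[OF _ _ int_bg]) measurable
  ultimately show ?thesis
    using AE_space
  proof eventually_elim
    case (elim x)
    then have "f x > 0" using f_ge[of x] by simp
    \<comment> \<open>With these forms the term \<open>- p * f x powr p\<close> of the tangent joins
      the slope term over the common denominator \<open>f x powr (1 - p)\<close>, the one that
      occurs in \<open>drift_outside\<close>.\<close>
    then have "f x powr p = f x / f x powr (1 - p)" "f x powr (p - 1) = 1 / f x powr (1 - p)"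
      using powr_add[of "f x" p "1 - p"] powr_minus_divide[of "f x" "1 - p"]
      by (simp_all add: field_simps)
    with elim(1-4) show ?case
      by (simp add: diff_divide_distrib algebra_simps)
  qed
qed

section \<open>Recurrence from a drift with divergent total\<close>

lemma (in prob_space) AE_INFM_not_drift:
  fixes Y :: "nat \<Rightarrow> 'a \<Rightarrow> real"
  assumes sub: "\<And>n. subalgebra M (F n)"
    and mono: "\<And>n. subalgebra (F (Suc n)) (F n)"
    and Y_F: "\<And>n. n \<ge> n\<^sub>0 \<Longrightarrow> Y n \<in> borel_measurable (F n)"
    and Y_int: "\<And>n. n \<ge> n\<^sub>0 \<Longrightarrow> integrable M (Y n)"
    and Y_nonneg: "\<And>n \<omega>. n \<ge> n\<^sub>0 \<Longrightarrow> \<omega> \<in> space M \<Longrightarrow> 0 \<le> Y n \<omega>"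
    and c_nonneg: "\<And>n. 0 \<le> c n"
    and c_div: "\<not> summable c"
  shows "AE \<omega> in M. \<exists>\<^sub>\<infinity>n. \<not> real_cond_exp M (F n) (Y (Suc n)) \<omega> \<le> Y n \<omega> - c n"
proof -
  let ?E = "\<lambda>n. real_cond_exp M (F n) (Y (Suc n))"
  have "AE \<omega> in M. \<exists>n\<ge>m. \<not> ?E n \<omega> \<le> Y n \<omega> - c n" if m: "m \<ge> n\<^sub>0" for m
  proof -
    \<comment> \<open>\<open>A k\<close> says that no failure occurs before time
      \<open>m + k\<close>, and \<open>B\<close> is the intersection of all \<open>A k\<close>. The
      quantity that telescopes is \<open>a k\<close>, the mean of the process on the paths without
      failure so far.\<close>
    define A where "A k = {\<omega>\<in>space M. \<forall>i<k. ?E (m + i) \<omega> \<le> Y (m + i) \<omega> - c (m + i)}" for k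
    define B where "B = {\<omega>\<in>space M. \<forall>i. ?E (m + i) \<omega> \<le> Y (m + i) \<omega> - c (m + i)}"
    define a where "a k = (\<integral>\<omega>\<in>A k. Y (m + k) \<omega> \<partial>M)" for k
    have space_F: "space (F n) = space M" for n
      using sub[of n] by (simp add: subalgebra_def)
    have Y_M [measurable]: "Y (m + i) \<in> borel_measurable M" for i
      using Y_int[of "m + i"] m by auto
    have [measurable]: "?E n \<in> borel_measurable M" for n
      by (rule borel_measurable_cond_exp2)
    have B_M [measurable]: "B \<in> sets M" unfolding B_def by measurable
    have A_M [measurable]: "A k \<in> sets M" for k unfolding A_def by measurable
    have F_le: "sets (F n) \<subseteq> sets (F (n + d))" for n d
      by (induction d) (use mono in \<open>auto simp: subalgebra_def\<close>)
    \<comment> \<open>\<open>A (Suc k)\<close> constrains times up to \<open>m + k\<close> only, and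
      both sides of the inequality at time \<open>m + i\<close> are measurable for
      \<open>F (m + i)\<close>. Hence conditioning on \<open>F (m + k)\<close> is compatible with
      integrating over \<open>A (Suc k)\<close>.\<close>
    have A_F: "A (Suc k) \<in> sets (F (m + k))" for k
    proof -
      have "{\<omega>\<in>space (F (m + i)). ?E (m + i) \<omega> \<le> Y (m + i) \<omega> - c (m + i)} \<in> sets (F (m + k))"
        if "i \<le> k" for i
      proof -
        have [measurable]: "Y (m + i) \<in> borel_measurable (F (m + i))"
          using Y_F m by simp
        have "{\<omega>\<in>space (F (m + i)). ?E (m + i) \<omega> \<le> Y (m + i) \<omega> - c (m + i)} \<in> sets (F (m + i))"
          by measurable
        then show ?thesis
          using F_le[of "m + i" "k - i"] that by auto
      qed
      then have "(\<Inter>i\<in>{..k}. {\<omega>\<in>space (F (m + i)). ?E (m + i) \<omega> \<le> Y (m + i) \<omega> - c (m + i)})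
          \<in> sets (F (m + k))"
        by (intro sets.finite_INT) auto
      also have "(\<Inter>i\<in>{..k}. {\<omega>\<in>space (F (m + i)). ?E (m + i) \<omega> \<le> Y (m + i) \<omega> - c (m + i)})
          = A (Suc k)"
        by (auto simp: A_def space_F less_Suc_eq_le)
      finally show ?thesis .
    qed
    \<comment> \<open>On \<open>A (Suc k)\<close> the conditional expectation may replace
      \<open>Y (Suc (m + k))\<close>, and the drift there costs
      \<open>c (m + k) * prob (A (Suc k))\<close>, which is at least the amount with
      \<open>B\<close>. Enlarging the domain from \<open>A (Suc k)\<close> to \<open>A k\<close>
      only increases the integral because \<open>Y\<close> is nonnegative.\<close>
    have step: "a (Suc k) + c (m + k) * prob B \<le> a k" for k
    proof -
      interpret G: finite_measure_subalgebra M "F (m + k)"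
        by unfold_locales (rule sub)
      have int: "integrable M (Y (m + k))" "integrable M (Y (Suc (m + k)))"
        using Y_int m by auto
      have intE: "integrable M (?E (m + k))"
        by (rule G.real_cond_exp_int(1)[OF int(2)])
      have intA: "set_integrable M (A j) f" if "integrable M f" for j and f :: "'a \<Rightarrow> real"
        unfolding set_integrable_def using that by (intro integrable_mult_indicator) auto
      have "a (Suc k) = (\<integral>\<omega>\<in>A (Suc k). ?E (m + k) \<omega> \<partial>M)"
        unfolding a_def using G.real_cond_exp_intA[OF int(2) A_F] by simp
      also have "\<dots> \<le> (\<integral>\<omega>\<in>A (Suc k). (Y (m + k) \<omega> - c (m + k)) \<partial>M)"
      proof (rule set_integral_mono)
        show "set_integrable M (A (Suc k)) (?E (m + k))"
          "set_integrable M (A (Suc k)) (\<lambda>\<omega>. Y (m + k) \<omega> - c (m + k))"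
          using int intE by (auto intro: intA)
      qed (simp add: A_def)
      also have "\<dots> = (\<integral>\<omega>\<in>A (Suc k). Y (m + k) \<omega> \<partial>M) - c (m + k) * prob (A (Suc k))"
        using set_integral_diff(2)[OF intA[OF int(1)] intA[of "\<lambda>_. c (m + k)"]]
        by (simp add: set_lebesgue_integral_def)
      also have "(\<integral>\<omega>\<in>A (Suc k). Y (m + k) \<omega> \<partial>M) \<le> a k"
        unfolding a_def set_lebesgue_integral_def
      proof (rule integral_mono)
        show "integrable M (\<lambda>\<omega>. indicator (A (Suc k)) \<omega> *\<^sub>R Y (m + k) \<omega>)"
          "integrable M (\<lambda>\<omega>. indicator (A k) \<omega> *\<^sub>R Y (m + k) \<omega>)"
          using intA[OF int(1)] by (simp_all add: set_integrable_def)
        show "indicator (A (Suc k)) \<omega> *\<^sub>R Y (m + k) \<omega> \<le> indicator (A k) \<omega> *\<^sub>R Y (m + k) \<omega>"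
          if "\<omega> \<in> space M" for \<omega>
          using Y_nonneg[OF _ that, of "m + k"] m by (auto simp: A_def split: split_indicator)
      qed
      finally have "a (Suc k) + c (m + k) * prob (A (Suc k)) \<le> a k"
        by simp
      moreover have "c (m + k) * prob B \<le> c (m + k) * prob (A (Suc k))"
        using c_nonneg by (intro mult_left_mono finite_measure_mono) (auto simp: A_def B_def)
      ultimately show ?thesis
        by linarith
    qed
    have a_nonneg: "0 \<le> a k" for k
      unfolding a_def set_lebesgue_integral_def
      using m Y_nonneg by (intro Bochner_Integration.integral_nonneg) auto
    have telescope: "a k + (\<Sum>i<k. c (m + i) * prob B) \<le> a 0" for k
    proof (induction k)
      case (Suc k)
      then show ?case
        using step[of k] by simp
    qed simp
    have "prob B = 0"
    proof (rule ccontr)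
      assume "prob B \<noteq> 0"
      have "summable (\<lambda>i. c (m + i) * prob B)"
      proof (rule summableI_nonneg_bounded)
        show "(\<Sum>i<k. c (m + i) * prob B) \<le> a 0" for k
          using telescope[of k] a_nonneg[of k] by linarith
      qed (use c_nonneg in auto)
      then have "summable (\<lambda>i. c (i + m))"
        using summable_mult2[of "\<lambda>i. c (m + i) * prob B" "1 / prob B"] \<open>prob B \<noteq> 0\<close>
        by (simp add: add.commute)
      with c_div show False
        by (simp only: summable_iff_shift)
    qed
    then have "AE \<omega> in M. \<omega> \<notin> B"
      using B_M by (simp add: AE_iff_null_sets[symmetric] null_setsI emeasure_eq_measure)
    then show ?thesis
    proof (rule AE_mp, intro AE_I2 impI)
      fix \<omega> assume "\<omega> \<in> space M" "\<omega> \<notin> B"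
      then obtain i where "\<not> ?E (m + i) \<omega> \<le> Y (m + i) \<omega> - c (m + i)"
        unfolding B_def by blast
      then show "\<exists>n\<ge>m. \<not> ?E n \<omega> \<le> Y n \<omega> - c n"
        by (intro exI[of _ "m + i"]) simp
    qed
  qed
  \<comment> \<open>A failure after each of countably many starting times gives infinitely many
    failures; the shift by \<open>n\<^sub>0\<close> keeps the starting times in the admissible
    range.\<close>
  then have "AE \<omega> in M. \<forall>m. \<exists>n\<ge>m + n\<^sub>0. \<not> ?E n \<omega> \<le> Y n \<omega> - c n"
    by (simp add: AE_all_countable)
  then show ?thesis
    unfolding INFM_nat_le by eventually_elim (meson add_leD1)
qed

text \<open>A finite sum would force the indicators to tend to 0; taking only the values 0 and 1,
  they would eventually vanish.\<close>

lemma suminf_indicator_eq_top: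
  assumes "\<exists>\<^sub>\<infinity>n. x n \<in> C"
  shows "(\<Sum>n. indicator C (x n) :: ennreal) = \<infinity>"
proof (rule ccontr)
  assume "(\<Sum>n. indicator C (x n) :: ennreal) \<noteq> \<infinity>"
  then have "summable (\<lambda>n. indicator C (x n) :: real)"
    by (intro summable_suminf_not_top) (simp_all add: ennreal_indicator)
  then have "(\<lambda>n. indicator C (x n) :: real) \<longlonglongrightarrow> 0"
    by (rule summable_LIMSEQ_zero)
  then have "\<forall>\<^sub>F n in sequentially. indicator C (x n) < (1 :: real)"
    by (rule order_tendstoD) simp
  then have "\<forall>\<^sub>F n in sequentially. x n \<notin> C"
    by eventually_elim (auto split: split_indicator_asm)
  with assms show False
    by (simp add: frequently_def cofinite_eq_sequentially)
qed

section \<open>The history filtration and adaptedness of the chain\<close>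

context controlled_markov_chain
begin

abbreviation "\<F> \<equiv> history_algebra M \<X> \<Theta> \<theta> X"

lemma space_history: "space (\<F> i) = space M"
  by (simp add: history_algebra_def)

lemma history_measurable:
  "(\<lambda>\<omega>. (\<theta> 0 \<omega>, \<lambda>j\<in>{..i}. X j \<omega>)) \<in>
    \<F> i \<rightarrow>\<^sub>M restrict_space borel \<Theta> \<Otimes>\<^sub>M (\<Pi>\<^sub>M j\<in>{..i}. restrict_space borel \<X>)"
  unfolding history_algebra_def
proof (rule measurable_vimage_algebra1)
  show "(\<lambda>\<omega>. (\<theta> 0 \<omega>, \<lambda>j\<in>{..i}. X j \<omega>)) \<in>
      space M \<rightarrow> space (restrict_space borel \<Theta> \<Otimes>\<^sub>M (\<Pi>\<^sub>M j\<in>{..i}. restrict_space borel \<X>))"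
    using measurable_space[OF measurable_\<theta>\<^sub>0] measurable_space[OF measurable_X]
    by (auto simp: space_pair_measure space_PiM)
qed

lemma X_history_measurable:
  assumes "j \<le> i"
  shows "X j \<in> \<F> i \<rightarrow>\<^sub>M restrict_space borel \<X>"
proof -
  have "(\<lambda>\<omega>. (snd (\<theta> 0 \<omega>, \<lambda>j\<in>{..i}. X j \<omega>)) j) \<in> \<F> i \<rightarrow>\<^sub>M restrict_space borel \<X>"
    using assms by (intro measurable_compose[OF measurable_compose[OF history_measurable measurable_snd]
      measurable_component_singleton]) auto
  with assms show ?thesis
    by simp
qed

text \<open>For positive \<open>i\<close> the parameter is \<open>\<phi> i\<close> applied to the
  very map that generates \<open>\<F> i\<close>; for \<open>i = 0\<close> it is the first component
  of that map.\<close>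

lemma \<theta>_history_measurable: "\<theta> i \<in> \<F> i \<rightarrow>\<^sub>M restrict_space borel \<Theta>"
proof (cases i)
  case 0
  then show ?thesis
    using measurable_compose[OF history_measurable measurable_fst, of i] by simp
next
  case (Suc k)
  have "(\<lambda>\<omega>. \<phi> (Suc k) (\<theta> 0 \<omega>) (\<lambda>j\<in>{..Suc k}. X j \<omega>)) \<in> \<F> (Suc k) \<rightarrow>\<^sub>M restrict_space borel \<Theta>"
    using measurable_compose[OF history_measurable measurable_\<phi>, of "Suc k"] by simp
  then show ?thesis
    \<comment> \<open>The recursion \<open>parameter\<close> holds at every sample point, so
      measurability transfers without completing \<open>\<F>\<close>.\<close>
    unfolding Suc by (subst measurable_cong[OF parameter]) (auto simp: space_history)
qed

text \<open>The map generating \<open>\<F> i\<close> is measurable for \<open>\<F> (Suc i)\<close>,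
  and \<open>\<F> i\<close> is the smallest algebra with that property.\<close>

lemma subalgebra_history_Suc: "subalgebra (\<F> (Suc i)) (\<F> i)"
proof -
  have "(\<lambda>\<omega>. (\<theta> 0 \<omega>, \<lambda>j\<in>{..i}. X j \<omega>)) \<in>
      \<F> (Suc i) \<rightarrow>\<^sub>M restrict_space borel \<Theta> \<Otimes>\<^sub>M (\<Pi>\<^sub>M j\<in>{..i}. restrict_space borel \<X>)"
    using measurable_compose[OF history_measurable measurable_fst, of "Suc i"]
    by (intro measurable_Pair measurable_restrict X_history_measurable) auto
  then have "sets (\<F> i) \<subseteq> sets (\<F> (Suc i))"
    unfolding history_algebra_def[of M \<X> \<Theta> \<theta> X i]
    by (intro sets_image_in_sets) (auto simp: space_history)
  then show ?thesis
    by (simp add: subalgebra_def space_history)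
qed

lemma state_in: "\<omega> \<in> space M \<Longrightarrow> \<theta> i \<omega> \<in> \<Theta>" "\<omega> \<in> space M \<Longrightarrow> X i \<omega> \<in> \<X>"
  using measurable_space[OF \<theta>_history_measurable, of \<omega> i] measurable_space[OF measurable_X, of \<omega> i]
  by (auto simp: space_history space_restrict_space)

end

section \<open>Drift and recurrence for \<open>W\<close> and \<open>U\<close>\<close>

context drift_assumption
begin

abbreviation "W \<equiv> W_fun V w \<gamma> \<upsilon>\<^sub>v \<upsilon>\<^sub>w"
abbreviation "U \<equiv> U_fun V w \<gamma> \<upsilon>\<^sub>v \<upsilon>\<^sub>w"

lemma V_history_measurable [measurable]: "(\<lambda>\<omega>. V (X i \<omega>)) \<in> borel_measurable (\<F> i)"
  by (rule measurable_compose[OF X_history_measurable V_measurable]) simp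

lemma w_history_measurable [measurable]: "(\<lambda>\<omega>. w (\<theta> i \<omega>)) \<in> borel_measurable (\<F> i)"
  by (rule measurable_compose[OF \<theta>_history_measurable w_measurable])

lemma V_state_ge_1: "\<omega> \<in> space M \<Longrightarrow> 1 \<le> V (X i \<omega>)"
  and w_state_ge_1: "\<omega> \<in> space M \<Longrightarrow> 1 \<le> w (\<theta> i \<omega>)"
  using V_ge_1 w_ge_1 state_in by auto

lemma W_history_measurable: "(\<lambda>\<omega>. W i (\<theta> i \<omega>) (X i \<omega>)) \<in> borel_measurable (\<F> i)"
  unfolding W_fun_def by measurable

lemma W_nonneg: "i \<ge> 1 \<Longrightarrow> 0 \<le> W i th x"
  using \<gamma>_pos[of i] by (simp add: W_fun_def)

lemma powr_integrable:
  assumes "i \<ge> i\<^sub>0"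
  shows "integrable M (\<lambda>\<omega>. V (X i \<omega>) powr \<upsilon>\<^sub>v)" "integrable M (\<lambda>\<omega>. w (\<theta> i \<omega>) powr \<upsilon>\<^sub>w)"
  using assms V_integrable w_integrable V_state_ge_1 w_state_ge_1 \<upsilon>\<^sub>v_range \<upsilon>\<^sub>w_range
  by (auto intro!: integrable_powr)

lemma W_integrable: "i \<ge> i\<^sub>0 \<Longrightarrow> integrable M (\<lambda>\<omega>. W i (\<theta> i \<omega>) (X i \<omega>))"
  unfolding W_fun_def using powr_integrable by simp

text \<open>Common core of both cases of \<open>s\<close>. The bound still has
  \<open>\<gamma> (Suc i)\<close> where \<open>W i\<close> has \<open>\<gamma> i\<close>; the two
  cases differ in how this mismatch is repaired.\<close>

lemma W_drift:
  assumes i: "i \<ge> i\<^sub>0"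
  shows "AE \<omega> in M. (\<theta> i \<omega>, X i \<omega>) \<notin> \<C> \<longrightarrow>
    real_cond_exp M (\<F> i) (\<lambda>\<omega>. W (Suc i) (\<theta> (Suc i) \<omega>) (X (Suc i) \<omega>)) \<omega>
      \<le> V (X i \<omega>) powr \<upsilon>\<^sub>v + w (\<theta> i \<omega>) powr \<upsilon>\<^sub>w / \<gamma> (Suc i)
        - \<delta> * w (\<theta> i \<omega>) powr (real s * \<upsilon>\<^sub>w)"
proof -
  interpret G: finite_measure_subalgebra M "\<F> i"
    by unfold_locales (rule subalgebra_history)
  let ?E = "real_cond_exp M (\<F> i)"
  have "AE \<omega> in M. ?E (\<lambda>\<omega>. V (X (Suc i) \<omega>) powr \<upsilon>\<^sub>v) \<omega> \<le> V (X i \<omega>) powr \<upsilon>\<^sub>v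
      + \<upsilon>\<^sub>v * ((?E (\<lambda>\<omega>. V (X (Suc i) \<omega>)) \<omega> - V (X i \<omega>)) / V (X i \<omega>) powr (1 - \<upsilon>\<^sub>v))"
    using i \<upsilon>\<^sub>v_range by (intro G.real_cond_exp_powr_le V_integrable V_state_ge_1) auto
  moreover have "AE \<omega> in M. ?E (\<lambda>\<omega>. w (\<theta> (Suc i) \<omega>) powr \<upsilon>\<^sub>w) \<omega> \<le> w (\<theta> i \<omega>) powr \<upsilon>\<^sub>w
      + \<upsilon>\<^sub>w * ((?E (\<lambda>\<omega>. w (\<theta> (Suc i) \<omega>)) \<omega> - w (\<theta> i \<omega>)) / w (\<theta> i \<omega>) powr (1 - \<upsilon>\<^sub>w))"
    using i \<upsilon>\<^sub>w_range by (intro G.real_cond_exp_powr_le w_integrable w_state_ge_1) auto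
  moreover have "AE \<omega> in M. ?E (\<lambda>\<omega>. W (Suc i) (\<theta> (Suc i) \<omega>) (X (Suc i) \<omega>)) \<omega>
      = ?E (\<lambda>\<omega>. V (X (Suc i) \<omega>) powr \<upsilon>\<^sub>v) \<omega> + ?E (\<lambda>\<omega>. w (\<theta> (Suc i) \<omega>) powr \<upsilon>\<^sub>w / \<gamma> (Suc i)) \<omega>"
    unfolding W_fun_def using i by (intro G.real_cond_exp_add) (auto intro!: powr_integrable)
  moreover have "AE \<omega> in M. ?E (\<lambda>\<omega>. w (\<theta> (Suc i) \<omega>) powr \<upsilon>\<^sub>w / \<gamma> (Suc i)) \<omega>
      = ?E (\<lambda>\<omega>. w (\<theta> (Suc i) \<omega>) powr \<upsilon>\<^sub>w) \<omega> / \<gamma> (Suc i)"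
    using i by (intro G.real_cond_exp_cdiv powr_integrable) simp
  ultimately show ?thesis
    using V_drift w_drift AE_space
  proof (eventually_elim, intro impI)
    case (elim \<omega>)
    let ?v = "V (X i \<omega>)" and ?w = "w (\<theta> i \<omega>)" and ?g = "\<gamma> (Suc i)"
    let ?dV = "\<Delta>\<^sub>V (\<theta> i \<omega>) (X i \<omega>)" and ?dw = "\<Delta>\<^sub>w (\<theta> i \<omega>) (X i \<omega>)"
    assume "(\<theta> i \<omega>, X i \<omega>) \<notin> \<C>"
    then have D: "\<upsilon>\<^sub>w * (?dw / ?w powr (1 - \<upsilon>\<^sub>w)) + \<upsilon>\<^sub>v * (?dV / ?v powr (1 - \<upsilon>\<^sub>v))
        \<ge> \<delta> * ?w powr (real s * \<upsilon>\<^sub>w)"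
      using drift_outside state_in elim(7) by blast
    have g: "?g > 0" using \<gamma>_pos by simp
    have "?E (\<lambda>\<omega>. V (X (Suc i) \<omega>)) \<omega> - ?v \<le> - ?dV"
      using elim(5) i by fastforce
    then have "\<upsilon>\<^sub>v * ((?E (\<lambda>\<omega>. V (X (Suc i) \<omega>)) \<omega> - ?v) / ?v powr (1 - \<upsilon>\<^sub>v))
        \<le> \<upsilon>\<^sub>v * (- ?dV / ?v powr (1 - \<upsilon>\<^sub>v))"
      using \<upsilon>\<^sub>v_range by (intro mult_left_mono divide_right_mono) auto
    with elim(1) have v: "?E (\<lambda>\<omega>. V (X (Suc i) \<omega>) powr \<upsilon>\<^sub>v) \<omega>
        \<le> ?v powr \<upsilon>\<^sub>v - \<upsilon>\<^sub>v * (?dV / ?v powr (1 - \<upsilon>\<^sub>v))"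
      by simp
    have "?E (\<lambda>\<omega>. w (\<theta> (Suc i) \<omega>)) \<omega> - ?w \<le> - (?g * ?dw)"
      using elim(6) i by fastforce
    then have "\<upsilon>\<^sub>w * ((?E (\<lambda>\<omega>. w (\<theta> (Suc i) \<omega>)) \<omega> - ?w) / ?w powr (1 - \<upsilon>\<^sub>w))
        \<le> \<upsilon>\<^sub>w * (- (?g * ?dw) / ?w powr (1 - \<upsilon>\<^sub>w))"
      using \<upsilon>\<^sub>w_range by (intro mult_left_mono divide_right_mono) auto
    with elim(2) have "?E (\<lambda>\<omega>. w (\<theta> (Suc i) \<omega>) powr \<upsilon>\<^sub>w) \<omega>
        \<le> ?w powr \<upsilon>\<^sub>w - ?g * (\<upsilon>\<^sub>w * (?dw / ?w powr (1 - \<upsilon>\<^sub>w)))"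
      by (simp add: mult_ac)
    \<comment> \<open>Dividing by \<open>?g\<close> cancels the step size in the drift of
      \<open>w\<close>, so that the two decrements add up to the left-hand side of
      \<open>D\<close>.\<close>
    then have "?E (\<lambda>\<omega>. w (\<theta> (Suc i) \<omega>) powr \<upsilon>\<^sub>w) \<omega> / ?g
        \<le> (?w powr \<upsilon>\<^sub>w - ?g * (\<upsilon>\<^sub>w * (?dw / ?w powr (1 - \<upsilon>\<^sub>w)))) / ?g"
      using g by (intro divide_right_mono) auto
    also have "\<dots> = ?w powr \<upsilon>\<^sub>w / ?g - \<upsilon>\<^sub>w * (?dw / ?w powr (1 - \<upsilon>\<^sub>w))"
      using g by (simp add: diff_divide_distrib)
    finally show "?E (\<lambda>\<omega>. W (Suc i) (\<theta> (Suc i) \<omega>) (X (Suc i) \<omega>)) \<omega>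
        \<le> ?v powr \<upsilon>\<^sub>v + ?w powr \<upsilon>\<^sub>w / ?g - \<delta> * ?w powr (real s * \<upsilon>\<^sub>w)"
      using v D elim(3,4) by linarith
  qed
qed

text \<open>The set \<open>\<C>\<close> need not be measurable, so the argument runs on the measurable event that the drift
  inequality itself holds; up to null sets it contains the event that the chain is outside \<open>\<C>\<close>.\<close>

lemma visits_infinitely_often:
  assumes Y_F: "\<And>n. n \<ge> n\<^sub>0 \<Longrightarrow> Y n \<in> borel_measurable (\<F> n)"
    and Y_int: "\<And>n. n \<ge> n\<^sub>0 \<Longrightarrow> integrable M (Y n)"
    and Y_nonneg: "\<And>n \<omega>. n \<ge> n\<^sub>0 \<Longrightarrow> \<omega> \<in> space M \<Longrightarrow> 0 \<le> Y n \<omega>"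
    and c: "\<And>n. 0 \<le> c n" "\<not> summable c"
    and drift: "\<And>n. n \<ge> n\<^sub>0 \<Longrightarrow> AE \<omega> in M. (\<theta> n \<omega>, X n \<omega>) \<notin> \<C> \<longrightarrow>
      real_cond_exp M (\<F> n) (Y (Suc n)) \<omega> \<le> Y n \<omega> - c n"
  shows "AE \<omega> in M. (\<Sum>i. indicator \<C> (\<theta> (i + 1) \<omega>, X (i + 1) \<omega>) :: ennreal) = \<infinity>"
proof -
  have "AE \<omega> in M. \<exists>\<^sub>\<infinity>n. \<not> real_cond_exp M (\<F> n) (Y (Suc n)) \<omega> \<le> Y n \<omega> - c n"
    using assms by (intro AE_INFM_not_drift[where n\<^sub>0 = n\<^sub>0] subalgebra_history subalgebra_history_Suc)
  moreover have "AE \<omega> in M. \<forall>n\<in>{n\<^sub>0..}. (\<theta> n \<omega>, X n \<omega>) \<notin> \<C> \<longrightarrow>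
      real_cond_exp M (\<F> n) (Y (Suc n)) \<omega> \<le> Y n \<omega> - c n"
    using drift by (intro AE_ball_countable') auto
  ultimately show ?thesis
  proof (eventually_elim)
    case (elim \<omega>)
    have "\<exists>n. n > m \<and> (\<theta> (n + 1) \<omega>, X (n + 1) \<omega>) \<in> \<C>" for m
    proof -
      \<comment> \<open>The sum counts visits from time 1 on, so a visit at time \<open>n\<close> is
        summand \<open>n - 1\<close>. The bound makes \<open>n - 1\<close> exceed \<open>m\<close>
        and places \<open>n\<close> where \<open>drift\<close> applies.\<close>
      obtain n where "n > m + n\<^sub>0 + 1" "\<not> real_cond_exp M (\<F> n) (Y (Suc n)) \<omega> \<le> Y n \<omega> - c n"
        using elim(1) unfolding INFM_nat by blast
      with elim(2) show ?thesis
        by (intro exI[of _ "n - 1"]) auto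
    qed
    then show ?case
      by (intro suminf_indicator_eq_top) (simp add: INFM_nat)
  qed
qed

text \<open>Replacing \<open>\<gamma> (i + 1)\<close> by \<open>\<gamma> i\<close> costs the
  increment of \<open>inverse \<gamma>\<close> times \<open>w powr \<upsilon>\<^sub>w\<close>. For
  \<open>s = 1\<close> the drift gains \<open>\<delta>\<close> times the same power, and the surplus
  is at least \<open>\<delta>\<^sub>W\<close> since that power is at least 1.\<close>

lemma W_drift_const:
  assumes "s = 1" "i \<ge> i\<^sub>0" "i \<ge> 1" "\<delta>\<^sub>W \<le> \<delta> - (inverse (\<gamma> (i + 1)) - inverse (\<gamma> i))" "0 < \<delta>\<^sub>W"
  shows "AE \<omega> in M. (\<theta> i \<omega>, X i \<omega>) \<notin> \<C> \<longrightarrow>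
    real_cond_exp M (\<F> i) (\<lambda>\<omega>. W (i + 1) (\<theta> (i + 1) \<omega>) (X (i + 1) \<omega>)) \<omega>
      \<le> W i (\<theta> i \<omega>) (X i \<omega>) - \<delta>\<^sub>W"
  using W_drift[OF assms(2)] AE_space
proof (eventually_elim, intro impI)
  case (elim \<omega>)
  assume "(\<theta> i \<omega>, X i \<omega>) \<notin> \<C>"
  let ?u = "w (\<theta> i \<omega>) powr \<upsilon>\<^sub>w"
  have "1 \<le> ?u"
    using w_state_ge_1[OF elim(2), of i] \<upsilon>\<^sub>w_range by (simp add: ge_one_powr_ge_zero)
  then have "\<delta>\<^sub>W * 1 \<le> \<delta>\<^sub>W * ?u"
    using assms by (intro mult_left_mono) auto
  also have "\<dots> \<le> (\<delta> - (inverse (\<gamma> (i + 1)) - inverse (\<gamma> i))) * ?u"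
    using assms by (intro mult_right_mono) auto
  finally show "real_cond_exp M (\<F> i) (\<lambda>\<omega>. W (i + 1) (\<theta> (i + 1) \<omega>) (X (i + 1) \<omega>)) \<omega>
      \<le> W i (\<theta> i \<omega>) (X i \<omega>) - \<delta>\<^sub>W"
    using elim(1) \<open>(\<theta> i \<omega>, X i \<omega>) \<notin> \<C>\<close> assms(1)
    by (simp add: W_fun_def algebra_simps divide_inverse)
qed

text \<open>Multiplying by \<open>\<gamma> (i + 1)\<close> frees the power of \<open>w\<close> from
  its weight, as in \<open>U i\<close>. Only the power of \<open>V\<close> keeps the factor
  \<open>\<gamma> (i + 1)\<close>, and monotonicity raises it to \<open>\<gamma> i\<close>.\<close>

lemma U_drift:
  assumes "s = 0" "antimono_on {1..} \<gamma>" "i \<ge> i\<^sub>0" "i \<ge> 1"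
  shows "AE \<omega> in M. (\<theta> i \<omega>, X i \<omega>) \<notin> \<C> \<longrightarrow>
    real_cond_exp M (\<F> i) (\<lambda>\<omega>. U (i + 1) (\<theta> (i + 1) \<omega>) (X (i + 1) \<omega>)) \<omega>
      \<le> U i (\<theta> i \<omega>) (X i \<omega>) - \<delta> * \<gamma> (i + 1)"
proof -
  interpret G: finite_measure_subalgebra M "\<F> i"
    by unfold_locales (rule subalgebra_history)
  have "AE \<omega> in M. real_cond_exp M (\<F> i) (\<lambda>\<omega>. U (i + 1) (\<theta> (i + 1) \<omega>) (X (i + 1) \<omega>)) \<omega>
      = \<gamma> (i + 1) * real_cond_exp M (\<F> i) (\<lambda>\<omega>. W (i + 1) (\<theta> (i + 1) \<omega>) (X (i + 1) \<omega>)) \<omega>"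
    unfolding U_fun_def using assms by (intro G.real_cond_exp_cmult W_integrable) simp
  then show ?thesis
    using W_drift[OF assms(3)] AE_space
  proof (eventually_elim, intro impI)
    case (elim \<omega>)
    let ?v = "V (X i \<omega>) powr \<upsilon>\<^sub>v" and ?u = "w (\<theta> i \<omega>) powr \<upsilon>\<^sub>w" and ?g = "\<gamma> (i + 1)"
    assume C: "(\<theta> i \<omega>, X i \<omega>) \<notin> \<C>"
    have pos: "?g > 0" "\<gamma> i > 0" and le: "?g \<le> \<gamma> i"
      using \<gamma>_pos assms by (auto simp: monotone_on_def)
    \<comment> \<open>Since \<open>0 powr 0 = 0\<close>, the value 1 rests on \<open>w\<close> being
      nonzero.\<close>
    have "w (\<theta> i \<omega>) powr (real s * \<upsilon>\<^sub>w) = 1"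
      using w_state_ge_1[OF elim(3), of i] assms(1) by simp
    with elim(2) C have "real_cond_exp M (\<F> i) (\<lambda>\<omega>. W (i + 1) (\<theta> (i + 1) \<omega>) (X (i + 1) \<omega>)) \<omega>
        \<le> ?v + ?u / ?g - \<delta>"
      by simp
    then have "?g * real_cond_exp M (\<F> i) (\<lambda>\<omega>. W (i + 1) (\<theta> (i + 1) \<omega>) (X (i + 1) \<omega>)) \<omega>
        \<le> ?g * (?v + ?u / ?g - \<delta>)"
      using pos by (intro mult_left_mono) auto
    also have "\<dots> = ?g * ?v + ?u - \<delta> * ?g"
      using pos by (simp add: algebra_simps)
    also have "?g * ?v \<le> \<gamma> i * ?v"
      using le by (intro mult_right_mono) auto
    finally show "real_cond_exp M (\<F> i) (\<lambda>\<omega>. U (i + 1) (\<theta> (i + 1) \<omega>) (X (i + 1) \<omega>)) \<omega>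
      \<le> U i (\<theta> i \<omega>) (X i \<omega>) - \<delta> * \<gamma> (i + 1)"
      using elim(1) pos by (simp add: U_fun_def W_fun_def algebra_simps)
  qed
qed

lemma ex_W_drift:
  assumes "s = 1" "0 < \<delta>\<^sub>W"
    and less: "ereal \<delta>\<^sub>W < ereal \<delta> - limsup (\<lambda>i. ereal (inverse (\<gamma> (i + 1)) - inverse (\<gamma> i)))"
  shows "\<exists>i\<^sub>W\<ge>max i\<^sub>0 1. \<forall>i\<ge>i\<^sub>W.
    (AE \<omega> in M. (\<theta> i \<omega>, X i \<omega>) \<notin> \<C> \<longrightarrow>
      real_cond_exp M (\<F> i) (\<lambda>\<omega>. W (i + 1) (\<theta> (i + 1) \<omega>) (X (i + 1) \<omega>)) \<omega>
        \<le> W i (\<theta> i \<omega>) (X i \<omega>) - \<delta>\<^sub>W) \<and>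
    integrable M (\<lambda>\<omega>. W i (\<theta> i \<omega>) (X i \<omega>))"
proof -
  \<comment> \<open>The case split treats an infinite limsup: the value \<infinity> contradicts
    \<open>less\<close>, and for -\<infinity> the claim is immediate. A strict bound on the limsup
    then holds for all late increments.\<close>
  have "limsup (\<lambda>i. ereal (inverse (\<gamma> (i + 1)) - inverse (\<gamma> i))) < ereal (\<delta> - \<delta>\<^sub>W)"
    using less by (cases "limsup (\<lambda>i. ereal (inverse (\<gamma> (i + 1)) - inverse (\<gamma> i)))") auto
  from Limsup_lessD[OF this]
  obtain N where "\<And>i. i \<ge> N \<Longrightarrow> inverse (\<gamma> (i + 1)) - inverse (\<gamma> i) < \<delta> - \<delta>\<^sub>W"
    by (auto simp: eventually_sequentially)
  then have "\<delta>\<^sub>W \<le> \<delta> - (inverse (\<gamma> (i + 1)) - inverse (\<gamma> i))" if "i \<ge> N" for i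
    using that by (smt (verit))
  then show ?thesis
    using assms(1,2)
    by (intro exI[of _ "max N (max i\<^sub>0 1)"]) (auto intro!: W_drift_const[simplified] W_integrable)
qed

text \<open>Any real \<open>d\<close> strictly between 0 and \<open>\<delta>\<close> minus the
  limsup serves as constant decrement, and a positive constant is not summable.\<close>

lemma W_visits:
  assumes "s = 1" and less: "limsup (\<lambda>i. ereal (inverse (\<gamma> (i + 1)) - inverse (\<gamma> i))) < ereal \<delta>"
  shows "AE \<omega> in M. (\<Sum>i. indicator \<C> (\<theta> (i + 1) \<omega>, X (i + 1) \<omega>) :: ennreal) = \<infinity>"
proof -
  let ?l = "limsup (\<lambda>i. ereal (inverse (\<gamma> (i + 1)) - inverse (\<gamma> i)))"
  have "0 < ereal \<delta> - ?l"
    using less by (cases ?l) auto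
  then obtain d where d: "0 < d" "ereal d < ereal \<delta> - ?l"
    using ereal_dense2[of 0 "ereal \<delta> - ?l"] by auto
  obtain N where N: "N \<ge> max i\<^sub>0 1" "\<And>i. i \<ge> N \<Longrightarrow> AE \<omega> in M. (\<theta> i \<omega>, X i \<omega>) \<notin> \<C> \<longrightarrow>
      real_cond_exp M (\<F> i) (\<lambda>\<omega>. W (i + 1) (\<theta> (i + 1) \<omega>) (X (i + 1) \<omega>)) \<omega>
        \<le> W i (\<theta> i \<omega>) (X i \<omega>) - d"
    using ex_W_drift[OF assms(1) d] by blast
  show ?thesis
    using N d by (intro visits_infinitely_often[where n\<^sub>0 = N and c = "\<lambda>_. d"
        and Y = "\<lambda>i \<omega>. W i (\<theta> i \<omega>) (X i \<omega>)"] W_history_measurable W_integrable W_nonneg)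
      (auto simp: summable_const_iff)
qed

lemma U_integrable: "i \<ge> i\<^sub>0 \<Longrightarrow> integrable M (\<lambda>\<omega>. U i (\<theta> i \<omega>) (X i \<omega>))"
  unfolding U_fun_def using W_integrable by simp

lemma U_visits:
  assumes "s = 0" "antimono_on {1..} \<gamma>" and div: "(\<Sum>i. ennreal (\<gamma> (i + 1))) = \<infinity>"
  shows "AE \<omega> in M. (\<Sum>i. indicator \<C> (\<theta> (i + 1) \<omega>, X (i + 1) \<omega>) :: ennreal) = \<infinity>"
proof (rule visits_infinitely_often[where n\<^sub>0 = "max i\<^sub>0 1" and c = "\<lambda>i. \<delta> * \<gamma> (i + 1)"
      and Y = "\<lambda>i \<omega>. U i (\<theta> i \<omega>) (X i \<omega>)"])
  \<comment> \<open>The shifted index avoids \<open>\<gamma> 0\<close>, whose sign is unconstrained;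
    \<open>n\<^sub>0 \<ge> 1\<close> serves the same purpose for the nonnegativity of
    \<open>U\<close>.\<close>
  have pos: "\<gamma> (i + 1) > 0" for i using \<gamma>_pos by simp
  then show "0 \<le> \<delta> * \<gamma> (i + 1)" for i
    using \<delta>_pos by (simp add: less_imp_le)
  have "\<not> summable (\<lambda>i. \<gamma> (i + 1))"
    using ennreal_suminf_neq_top[of "\<lambda>i. \<gamma> (i + 1)"] div pos by (auto simp: less_imp_le)
  then show "\<not> summable (\<lambda>i. \<delta> * \<gamma> (i + 1))"
    using \<delta>_pos by simp
  show "(\<lambda>\<omega>. U i (\<theta> i \<omega>) (X i \<omega>)) \<in> borel_measurable (\<F> i)" for i
    unfolding U_fun_def using W_history_measurable by simp
  show "0 \<le> U i (\<theta> i \<omega>) (X i \<omega>)" if "i \<ge> max i\<^sub>0 1" for i \<omega>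
    using that W_nonneg \<gamma>_pos[of i] by (simp add: U_fun_def)
qed (use U_drift[OF assms(1,2)] U_integrable in auto)

end

section \<open>Drift, integrability and recurrence collected for \<open>s = 1\<close> and
  \<open>s = 0\<close>\<close>

theorem theorem1:
  fixes M :: "'w measure"
    and \<X> :: "(real ^ 'nx) set"
    and \<Theta> :: "(real ^ 'nt) set"
    and P :: "real ^ 'nt \<Rightarrow> real ^ 'nx \<Rightarrow> (real ^ 'nx) measure"
    and \<phi> :: "nat \<Rightarrow> real ^ 'nt \<Rightarrow> (nat \<Rightarrow> real ^ 'nx) \<Rightarrow> real ^ 'nt"
    and \<theta>\<^sub>0 :: "real ^ 'nt"
    and x\<^sub>0 :: "real ^ 'nx"
    and \<theta> :: "nat \<Rightarrow> 'w \<Rightarrow> real ^ 'nt"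
    and X :: "nat \<Rightarrow> 'w \<Rightarrow> real ^ 'nx"
    and s :: nat
    and V :: "real ^ 'nx \<Rightarrow> real"
    and w :: "real ^ 'nt \<Rightarrow> real"
    and \<Delta>\<^sub>V \<Delta>\<^sub>w :: "real ^ 'nt \<Rightarrow> real ^ 'nx \<Rightarrow> real"
    and \<C> :: "((real ^ 'nt) \<times> (real ^ 'nx)) set"
    and \<gamma> :: "nat \<Rightarrow> real"
    and i\<^sub>0 :: nat
    and \<delta> \<upsilon>\<^sub>v \<upsilon>\<^sub>w :: real
  defines "\<F> \<equiv> history_algebra M \<X> \<Theta> \<theta> X"
    and "W \<equiv> W_fun V w \<gamma> \<upsilon>\<^sub>v \<upsilon>\<^sub>w"
    and "U \<equiv> U_fun V w \<gamma> \<upsilon>\<^sub>v \<upsilon>\<^sub>w"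
    and "lbar \<equiv> limsup (\<lambda>i. ereal (inverse (\<gamma> (i + 1)) - inverse (\<gamma> i)))"
  assumes A1: "drift_assumption M \<X> \<Theta> P \<phi> \<theta>\<^sub>0 x\<^sub>0 \<theta> X s V w \<Delta>\<^sub>V \<Delta>\<^sub>w \<C> \<gamma> i\<^sub>0 \<delta> \<upsilon>\<^sub>v \<upsilon>\<^sub>w"
  shows
    "(s = 1 \<and> lbar < ereal \<delta> \<longrightarrow>
        (\<forall>\<delta>\<^sub>W. 0 < \<delta>\<^sub>W \<and> ereal \<delta>\<^sub>W < ereal \<delta> - lbar \<longrightarrow>
          (\<exists>i\<^sub>W \<ge> max i\<^sub>0 1. \<forall>i\<ge>i\<^sub>W.
            (AE \<omega> in M. (\<theta> i \<omega>, X i \<omega>) \<notin> \<C> \<longrightarrow>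
              real_cond_exp M (\<F> i) (\<lambda>\<omega>. W (i + 1) (\<theta> (i + 1) \<omega>) (X (i + 1) \<omega>)) \<omega>
                \<le> W i (\<theta> i \<omega>) (X i \<omega>) - \<delta>\<^sub>W) \<and>
            integrable M (\<lambda>\<omega>. W i (\<theta> i \<omega>) (X i \<omega>)))) \<and>
        (AE \<omega> in M. (\<Sum>i. indicator \<C> (\<theta> (i + 1) \<omega>, X (i + 1) \<omega>) :: ennreal) = \<infinity>))
     \<and> (s = 0 \<and> antimono_on {1..} \<gamma> \<longrightarrow>
        (\<forall>i \<ge> max i\<^sub>0 1.
          (AE \<omega> in M. (\<theta> i \<omega>, X i \<omega>) \<notin> \<C> \<longrightarrow>
            real_cond_exp M (\<F> i) (\<lambda>\<omega>. U (i + 1) (\<theta> (i + 1) \<omega>) (X (i + 1) \<omega>)) \<omega>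
              \<le> U i (\<theta> i \<omega>) (X i \<omega>) - \<delta> * \<gamma> (i + 1)) \<and>
          integrable M (\<lambda>\<omega>. U i (\<theta> i \<omega>) (X i \<omega>))) \<and>
        ((\<Sum>i. ennreal (\<gamma> (i + 1))) = \<infinity> \<longrightarrow>
          (AE \<omega> in M. (\<Sum>i. indicator \<C> (\<theta> (i + 1) \<omega>, X (i + 1) \<omega>) :: ennreal) = \<infinity>)))"
proof -
  interpret drift_assumption M \<X> \<Theta> P \<phi> \<theta>\<^sub>0 x\<^sub>0 \<theta> X s V w \<Delta>\<^sub>V \<Delta>\<^sub>w \<C> \<gamma> i\<^sub>0 \<delta> \<upsilon>\<^sub>v \<upsilon>\<^sub>w
    by (rule A1)
  show ?thesis
    unfolding \<F>_def W_def U_def lbar_def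
  proof (intro conjI impI allI, goal_cases)
    case 1 then show ?case using ex_W_drift by blast
  next
    case 2 then show ?case using W_visits by blast
  next
    case 3 then show ?case using U_drift by auto
  next
    case 4 then show ?case using U_integrable by auto
  next
    case 5 then show ?case using U_visits by blast
  qed
qed

end
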